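(* Let $d \ge 1$ and let $\{s_\alpha\}_{\alpha\in\mathbb{N}_0^d}$ be a positive multisequence with $s_{(0,\ldots,0)}=1$. Assume that for some $R>0$ one has $\lambda_{R,N}>0$ for all $N\in\mathbb{N}$. Then a reproducing kernel for the polynomials which is uniformly bounded on compact sets exists, i.e. for every compact set $E\subseteq\mathbb{C}^d$ there is a constant $M<\infty$ such that $$\sum_{\alpha\in\mathbb{N}_0^d}|P_\alpha(z)|^2\le M\quad\text{for all } z\in E,$$ if and only if $\gamma_R>0$ for every $R>0$.
   Context: Notation: $\mathbb{N}_0=\{0,1,2,\ldots\}$; for $\alpha\in\mathbb{N}_0^d$, $|\alpha|=\alpha_1+\cdots+\alpha_d$ and $x^\alpha=x_1^{\alpha_1}\cdots x_d^{\alpha_d}$; $\mathbb{C}[x]=\mathbb{C}[x_1,\ldots,x_d]$; for $p\in\mathbb{C}[x]$, $\overline{p}$ is the polynomial obtained by conjugating the coefficients of $p$. Given a multisequence $\{s_\alpha\}_{\alpha\in\mathbb{N}_0^d}$, let $L:\mathbb{C}[x]\to\mathbb{C}$ be the linear functional with $L(x^\alpha)=s_\alpha$. The multisequence is called positive if $L(p\overline{p})\ge 0$ for every $p\in\mathbb{C}[x]$. It is not assumed that $\{s_\alpha\}$ is the moment multisequence of a measure. Put $\langle p,q\rangle=L(p\overline{q})$. For $R>0$ and $N\in\mathbb{N}$, let $$H_{R,N}=\left(\frac{s_{\alpha+\beta}}{R^{|\alpha+\beta|}}\right)_{0\le|\alpha|,|\beta|\le N}$$ (rows and columns indexed by multi-indices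 $\alpha,\beta\in\mathbb{N}_0^d$ of length at most $N$), let $\lambda_{R,N}$ be the smallest eigenvalue of $H_{R,N}$, and let $\gamma_R=\lim_{N\to\infty}\lambda_{R,N}$ (for each fixed $R$ the numbers $\lambda_{R,N}$ are nonnegative and nonincreasing in $N$, so the limit exists). If $\lambda_{R,N}>0$ for all $N$ for some $R>0$, then $\langle\cdot,\cdot\rangle$ is positive definite on $\mathbb{C}[x]$. In this case $\{P_\alpha\}_{\alpha\in\mathbb{N}_0^d}$ denotes the system of polynomials, orthonormal with respect to $\langle\cdot,\cdot\rangle$, obtained by applying Gram–Schmidt to the monomials $\{x^\alpha\}$ in graded lexicographic order; in particular $\deg P_\alpha=|\alpha|$. Let $\mathcal{P}$ be the Hilbert space completion of $\mathbb{C}[x]$ with respect to $\langle\cdot,\cdot\rangle$. A reproducing kernel for the polynomials is a function $K:\mathbb{C}^d\times\mathbb{C}^d\to\mathbb{C}$ with $p(y)=\langle p(x),K(x,y)\rangle_{\mathcal{P}}$ for all polynomials $p$ and all $y\in\mathbb{C}^d$; it is given by $K(x,y)=\sum_\alpha P_\alpha(x)\overline{P_\alpha(y)}$, and its existence with uniform boundedness on compact sets means that $\sum_\alpha|P_\alpha(z)|^2$ is uniformly bounded on each compact subset of $\mathbb{C}^d$. *)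

theory Defs
  imports "HOL-Analysis.Analysis" "HOL-Library.Poly_Mapping"
begin

text \<open>
  The number \<open>d \<ge> 1\<close> of variables is the cardinality of an index type \<open>'d\<close>; its linear order
  is only used to order the variables.  A multi-index is an element of \<open>'d \<Rightarrow>\<^sub>0 nat\<close>, and
  \<open>('d \<Rightarrow>\<^sub>0 nat) \<Rightarrow>\<^sub>0 complex\<close> with its convolution product is the ring of polynomials
  \<open>\<complex>[x\<^sub>1, \<dots>, x\<^sub>d]\<close> (coefficient functions of finite support).
\<close>

type_synonym 'd mindex = "'d \<Rightarrow>\<^sub>0 nat"
type_synonym 'd cpoly = "('d \<Rightarrow>\<^sub>0 nat) \<Rightarrow>\<^sub>0 complex"

definition mlen :: "('d::finite) mindex \<Rightarrow> nat" where
  "mlen \<alpha> = (\<Sum>i\<in>UNIV. Poly_Mapping.lookup \<alpha> i)"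

text \<open>
  The order \<open><\<close> of \<open>HOL-Library.Poly_Mapping\<close> on \<^typ>\<open>('d::linorder) mindex\<close> is the
  lexicographic one: at the smallest index where the entries differ, the left one is smaller.
\<close>

definition grlex_less :: "('d::{finite,linorder}) mindex \<Rightarrow> 'd mindex \<Rightarrow> bool" where
  "grlex_less \<alpha> \<beta> \<longleftrightarrow> mlen \<alpha> < mlen \<beta> \<or> mlen \<alpha> = mlen \<beta> \<and> \<alpha> < \<beta>"

definition monom_poly :: "'d mindex \<Rightarrow> 'd cpoly" where
  "monom_poly \<alpha> = Poly_Mapping.single \<alpha> 1"

definition scale_poly :: "complex \<Rightarrow> 'd cpoly \<Rightarrow> 'd cpoly" where
  "scale_poly c p = Poly_Mapping.map (\<lambda>a. c * a) p"

definition conj_poly :: "'d cpoly \<Rightarrow> 'd cpoly" where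
  "conj_poly p = Poly_Mapping.map cnj p"

definition eval_poly :: "('d::finite) cpoly \<Rightarrow> complex ^ 'd \<Rightarrow> complex" where
  "eval_poly p z = (\<Sum>\<alpha>\<in>Poly_Mapping.keys p. Poly_Mapping.lookup p \<alpha> * (\<Prod>i\<in>UNIV. (z $ i) ^ Poly_Mapping.lookup \<alpha> i))"

definition riesz :: "('d mindex \<Rightarrow> complex) \<Rightarrow> 'd cpoly \<Rightarrow> complex" where
  "riesz s p = (\<Sum>\<alpha>\<in>Poly_Mapping.keys p. Poly_Mapping.lookup p \<alpha> * s \<alpha>)"

definition pos_multiseq :: "('d mindex \<Rightarrow> complex) \<Rightarrow> bool" where
  "pos_multiseq s \<longleftrightarrow> (\<forall>p. riesz s (p * conj_poly p) \<in> \<real>\<^sub>\<ge>\<^sub>0)"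

definition ip :: "('d mindex \<Rightarrow> complex) \<Rightarrow> 'd cpoly \<Rightarrow> 'd cpoly \<Rightarrow> complex" where
  "ip s p q = riesz s (p * conj_poly q)"

text \<open>
  Matrices whose rows and columns are indexed by a finite set \<open>I\<close> are functions
  \<open>A\<close> of two arguments, of which only the values on \<open>I \<times> I\<close> matter.
\<close>

definition eigenvalue_on :: "'i set \<Rightarrow> ('i \<Rightarrow> 'i \<Rightarrow> complex) \<Rightarrow> complex \<Rightarrow> bool" where
  "eigenvalue_on I A \<mu> \<longleftrightarrow>
     (\<exists>v. (\<exists>i\<in>I. v i \<noteq> 0) \<and> (\<forall>i\<in>I. (\<Sum>j\<in>I. A i j * v j) = \<mu> * v i))"

definition hankel :: "(('d::finite) mindex \<Rightarrow> complex) \<Rightarrow> real \<Rightarrow> 'd mindex \<Rightarrow> 'd mindex \<Rightarrow> complex" where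
  "hankel s R \<alpha> \<beta> = s (\<alpha> + \<beta>) / of_real (R ^ mlen (\<alpha> + \<beta>))"

text \<open>
  For a positive multisequence the matrix is Hermitian, so all of its eigenvalues are real
  and the minimum is over a finite nonempty set.
\<close>

definition min_eigenvalue :: "(('d::finite) mindex \<Rightarrow> complex) \<Rightarrow> real \<Rightarrow> nat \<Rightarrow> real" where
  "min_eigenvalue s R N = Min {t. eigenvalue_on {\<alpha>. mlen \<alpha> \<le> N} (hankel s R) (of_real t)}"

definition gamma_lim :: "(('d::finite) mindex \<Rightarrow> complex) \<Rightarrow> real \<Rightarrow> real" where
  "gamma_lim s R = lim (\<lambda>N. min_eigenvalue s R N)"

lemma finite_mlen_le: "finite {\<alpha> :: ('d::finite) mindex. mlen \<alpha> \<le> N}"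
proof -
  have "Poly_Mapping.lookup \<alpha> i \<le> N" if "mlen \<alpha> \<le> N" for \<alpha> :: "'d mindex" and i
  proof -
    have "Poly_Mapping.lookup \<alpha> i \<le> mlen \<alpha>"
      unfolding mlen_def by (rule member_le_sum) auto
    with that show ?thesis by simp
  qed
  then have "Poly_Mapping.lookup ` {\<alpha> :: 'd mindex. mlen \<alpha> \<le> N} \<subseteq> PiE UNIV (\<lambda>_. {..N})"
    by (auto simp: PiE_def)
  moreover have "finite (PiE (UNIV :: 'd set) (\<lambda>_. {..N}))"
    by (intro finite_PiE) auto
  ultimately have "finite (Poly_Mapping.lookup ` {\<alpha> :: 'd mindex. mlen \<alpha> \<le> N})"
    by (rule finite_subset)
  moreover have "inj_on Poly_Mapping.lookup {\<alpha> :: 'd mindex. mlen \<alpha> \<le> N}"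
    by (simp add: inj_on_def Poly_Mapping.lookup_inject)
  ultimately show ?thesis by (rule finite_imageD)
qed

lemma finite_grlex_below: "finite {\<beta>. grlex_less \<beta> \<alpha>}"
  by (rule finite_subset[OF _ finite_mlen_le[of "mlen \<alpha>"]]) (auto simp: grlex_less_def)

lemma grlex_less_card:
  assumes "grlex_less \<beta> \<alpha>"
  shows "card {\<gamma>. grlex_less \<gamma> \<beta>} < card {\<gamma>. grlex_less \<gamma> \<alpha>}"
proof (rule psubset_card_mono[OF finite_grlex_below])
  have "\<beta> \<notin> {\<gamma>. grlex_less \<gamma> \<beta>}" by (simp add: grlex_less_def)
  moreover have "\<beta> \<in> {\<gamma>. grlex_less \<gamma> \<alpha>}" using assms by simp
  moreover have "{\<gamma>. grlex_less \<gamma> \<beta>} \<subseteq> {\<gamma>. grlex_less \<gamma> \<alpha>}"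
    using assms by (auto simp: grlex_less_def)
  ultimately show "{\<gamma>. grlex_less \<gamma> \<beta>} \<subset> {\<gamma>. grlex_less \<gamma> \<alpha>}" by blast
qed

definition normalize_poly :: "('d mindex \<Rightarrow> complex) \<Rightarrow> 'd cpoly \<Rightarrow> 'd cpoly" where
  "normalize_poly s q = scale_poly (of_real (1 / sqrt (Re (ip s q q)))) q"

text \<open>
  This is Gram--Schmidt for the monomials in graded lexicographic order.  It is meaningful only if
  \<open>ip s\<close> is positive definite; otherwise the normalising factor may be \<open>1 / 0 = 0\<close>.
\<close>

function orth_poly :: "(('d::{finite,linorder}) mindex \<Rightarrow> complex) \<Rightarrow> 'd mindex \<Rightarrow> 'd cpoly" where
  "orth_poly s \<alpha> = normalize_poly s
     (monom_poly \<alpha> - (\<Sum>\<beta>\<in>{\<beta>. grlex_less \<beta> \<alpha>}. scale_poly (ip s (monom_poly \<alpha>) (orth_poly s \<beta>)) (orth_poly s \<beta>)))"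
  by auto
termination
  by (relation "Wellfounded.measure (\<lambda>(s, \<alpha>). card {\<beta>. grlex_less \<beta> \<alpha>})") (auto intro: grlex_less_card)

declare orth_poly.simps [simp del]

end

theory Submission
  imports Defs
begin

text \<open>
  The smallest eigenvalue \<open>\<lambda>\<^bsub>R,N\<^esub>\<close> is the minimum of \<open>\<langle>p, p\<rangle>\<close> over polynomials of degree at
  most \<open>N\<close> whose weighted coefficient norm \<open>\<Sum>\<^sub>\<alpha> R\<^bsup>2|\<alpha>|\<^esup> |p\<^sub>\<alpha>|\<^sup>2\<close> is \<open>1\<close>.  Hence \<open>\<gamma>\<^sub>R > 0\<close>
  means that this norm is bounded by a multiple of \<open>\<langle>p, p\<rangle>\<close>.  On the other hand
  \<open>\<Sum>\<^sub>\<alpha> |P\<^sub>\<alpha>(z)|\<^sup>2\<close> is the squared norm of the evaluation functional at \<open>z\<close>.  By Cauchy--Schwarz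
  the weighted norm with radius \<open>2\<rho>\<close> dominates point evaluations on the polydisc of radius \<open>\<rho>\<close>,
  and conversely the weighted norm with radius \<open>R\<close> is the average of \<open>|p|\<^sup>2\<close> over the torus of
  radius \<open>R\<close>.
\<close>

section \<open>Coefficients, the Riesz functional and its sesquilinear form\<close>

abbreviation coef :: "'d cpoly \<Rightarrow> 'd mindex \<Rightarrow> complex" where
  "coef \<equiv> Poly_Mapping.lookup"

lemma coef_scale_poly [simp]: "coef (scale_poly c p) \<alpha> = c * coef p \<alpha>"
  by (simp add: scale_poly_def Poly_Mapping.map.rep_eq when_def)

lemma coef_conj_poly [simp]: "coef (conj_poly p) \<alpha> = cnj (coef p \<alpha>)"
  by (simp add: conj_poly_def Poly_Mapping.map.rep_eq when_def)

lemma coef_sum_single: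
  assumes "finite A"
  shows "coef (\<Sum>\<alpha>\<in>A. Poly_Mapping.single \<alpha> (c \<alpha>)) \<beta> = (if \<beta> \<in> A then c \<beta> else 0)"
  using assms by (simp add: lookup_sum lookup_single when_def)

lemma keys_conj_poly [simp]: "Poly_Mapping.keys (conj_poly p) = Poly_Mapping.keys p"
  by (auto simp: in_keys_iff)

lemma scale_poly_eq_mult: "scale_poly c p = Poly_Mapping.single 0 c * p"
  by (simp add: scale_poly_def mult_map_scale_conv_mult)

text \<open>Added terms have coefficient zero. The free set \<open>A\<close> lets several
  polynomials be summed over one common index set.\<close>

lemma riesz_superset:
  assumes "finite A" "Poly_Mapping.keys p \<subseteq> A"
  shows "riesz s p = (\<Sum>\<alpha>\<in>A. coef p \<alpha> * s \<alpha>)"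
  unfolding riesz_def using assms by (intro sum.mono_neutral_left) (auto simp: in_keys_iff)

lemma riesz_add: "riesz s (p + q) = riesz s p + riesz s q"
proof -
  let ?A = "Poly_Mapping.keys p \<union> Poly_Mapping.keys q"
  have "finite ?A" "Poly_Mapping.keys (p + q) \<subseteq> ?A"
    by (auto dest: subsetD[OF keys_add])
  then show ?thesis
    by (simp add: riesz_superset[of ?A] lookup_add distrib_right sum.distrib)
qed

lemma riesz_scale: "riesz s (scale_poly c p) = c * riesz s p"
proof -
  have "Poly_Mapping.keys (scale_poly c p) \<subseteq> Poly_Mapping.keys p"
    by (auto simp: in_keys_iff)
  then show ?thesis
    by (simp add: riesz_superset[of "Poly_Mapping.keys p"] sum_distrib_left mult.assoc)
qed

lemma riesz_zero [simp]: "riesz s 0 = 0"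
  by (simp add: riesz_def)

lemma riesz_sum: "riesz s (sum f A) = (\<Sum>x\<in>A. riesz s (f x))"
  by (induction A rule: infinite_finite_induct) (auto simp: riesz_add)

lemma riesz_single [simp]: "riesz s (Poly_Mapping.single \<alpha> c) = c * s \<alpha>"
  by (simp add: riesz_def)

lemma poly_eq_sum_single:
  assumes "finite A" "Poly_Mapping.keys p \<subseteq> A"
  shows "p = (\<Sum>\<alpha>\<in>A. Poly_Mapping.single \<alpha> (coef p \<alpha>))"
  by (rule poly_mapping_eqI) (use assms in \<open>auto simp: coef_sum_single in_keys_iff\<close>)

lemma ip_expand:
  assumes "finite A" "Poly_Mapping.keys p \<subseteq> A" "finite B" "Poly_Mapping.keys q \<subseteq> B"
  shows "ip s p q = (\<Sum>\<alpha>\<in>A. \<Sum>\<beta>\<in>B. coef p \<alpha> * cnj (coef q \<beta>) * s (\<alpha> + \<beta>))"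
proof -
  have "p * conj_poly q = (\<Sum>\<alpha>\<in>A. \<Sum>\<beta>\<in>B. Poly_Mapping.single (\<alpha> + \<beta>) (coef p \<alpha> * cnj (coef q \<beta>)))"
    by (subst poly_eq_sum_single[of A p], use assms in simp_all)
       (subst poly_eq_sum_single[of B "conj_poly q"],
        use assms in \<open>simp_all add: sum_product mult_single\<close>)
  then show ?thesis
    unfolding ip_def by (simp add: riesz_sum)
qed

lemma conj_poly_add: "conj_poly (p + q) = conj_poly p + conj_poly q"
  by (rule poly_mapping_eqI) (simp add: lookup_add)

lemma conj_poly_scale: "conj_poly (scale_poly c p) = scale_poly (cnj c) (conj_poly p)"
  by (rule poly_mapping_eqI) simp

lemma ip_add_left: "ip s (p + q) r = ip s p r + ip s q r"
  by (simp add: ip_def distrib_right riesz_add)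

lemma ip_add_right: "ip s p (q + r) = ip s p q + ip s p r"
  by (simp add: ip_def conj_poly_add distrib_left riesz_add)

lemma ip_scale_left [simp]: "ip s (scale_poly c p) q = c * ip s p q"
  by (simp add: ip_def scale_poly_eq_mult mult.assoc flip: riesz_scale)

lemma ip_scale_right [simp]: "ip s p (scale_poly c q) = cnj c * ip s p q"
proof -
  have "p * scale_poly (cnj c) (conj_poly q) = scale_poly (cnj c) (p * conj_poly q)"
    by (simp add: scale_poly_eq_mult mult.left_commute)
  then show ?thesis by (simp add: ip_def conj_poly_scale riesz_scale)
qed

lemma ip_zero_left [simp]: "ip s 0 p = 0"
  by (simp add: ip_def)

lemma ip_zero_right [simp]: "ip s p 0 = 0"
  using ip_scale_right[of s p 0 0] by (simp add: scale_poly_eq_mult)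

lemma ip_diff_left: "ip s (p - q) r = ip s p r - ip s q r"
  using ip_add_left[of s "p - q" q r] by simp

lemma ip_sum_left: "ip s (sum f A) q = (\<Sum>x\<in>A. ip s (f x) q)"
  by (induction A rule: infinite_finite_induct) (auto simp: ip_add_left)

lemma ip_sum_right: "ip s p (sum f A) = (\<Sum>x\<in>A. ip s p (f x))"
  by (induction A rule: infinite_finite_induct) (auto simp: ip_add_right)

lemma ip_single: "ip s (Poly_Mapping.single \<alpha> a) (Poly_Mapping.single \<beta> b) = a * cnj b * s (\<alpha> + \<beta>)"
  by (subst ip_expand[of "{\<alpha>}" _ "{\<beta>}"]) auto

lemma pos_multiseq_ip:
  assumes "pos_multiseq s"
  shows "Im (ip s p p) = 0" "Re (ip s p p) \<ge> 0"
  using assms unfolding pos_multiseq_def ip_def by (auto simp: complex_nonneg_Reals_iff)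

text \<open>Polarisation: \<open>ip s p p\<close> is real for the polynomials 1, x^\<alpha> and
  x^\<alpha> + 1. Both cross terms of the last one equal \<open>s \<alpha>\<close>, so
  \<open>2 * s \<alpha>\<close> is a combination of real numbers.\<close>

lemma pos_multiseq_real:
  assumes "pos_multiseq s"
  shows "cnj (s \<alpha>) = s \<alpha>"
proof -
  let ?x = "Poly_Mapping.single \<alpha> (1::complex)" and ?e = "Poly_Mapping.single 0 (1::complex)"
  have "ip s (?x + ?e) (?x + ?e) = ip s ?x ?x + ip s ?e ?e + 2 * s \<alpha>"
    by (simp only: ip_add_left ip_add_right ip_single) simp
  then have "Im (s \<alpha>) = 0"
    using pos_multiseq_ip(1)[OF assms, of "?x + ?e"] pos_multiseq_ip(1)[OF assms, of ?x]
      pos_multiseq_ip(1)[OF assms, of ?e] by simp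
  then show ?thesis by (simp add: complex_eq_iff)
qed

lemma ip_commute:
  assumes "pos_multiseq s"
  shows "ip s q p = cnj (ip s p q)"
proof -
  have "ip s q p = (\<Sum>\<beta>\<in>Poly_Mapping.keys q. \<Sum>\<alpha>\<in>Poly_Mapping.keys p. coef q \<beta> * cnj (coef p \<alpha>) * s (\<beta> + \<alpha>))"
    by (rule ip_expand) auto
  also have "\<dots> = (\<Sum>\<alpha>\<in>Poly_Mapping.keys p. \<Sum>\<beta>\<in>Poly_Mapping.keys q. coef q \<beta> * cnj (coef p \<alpha>) * s (\<beta> + \<alpha>))"
    by (rule sum.swap)
  also have "\<dots> = cnj (ip s p q)"
    by (subst ip_expand[of "Poly_Mapping.keys p" p "Poly_Mapping.keys q" q])
       (auto simp: pos_multiseq_real[OF assms] ac_simps)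
  finally show ?thesis .
qed

definition zpow :: "complex ^ 'd \<Rightarrow> ('d::finite) mindex \<Rightarrow> complex" where
  "zpow z \<alpha> = (\<Prod>i\<in>UNIV. (z $ i) ^ Poly_Mapping.lookup \<alpha> i)"

text \<open>Evaluation at \<open>z\<close> is the functional whose multisequence is \<alpha>
  \<mapsto> z^\<alpha>, so its linearity is inherited from \<open>riesz\<close>.\<close>

lemma eval_poly_eq_riesz: "eval_poly p z = riesz (zpow z) p"
  by (simp add: eval_poly_def riesz_def zpow_def)

lemma mlen_add: "mlen (\<alpha> + \<beta>) = mlen \<alpha> + mlen \<beta>"
  by (simp add: mlen_def lookup_add sum.distrib)

lemma lookup_le_mlen: "Poly_Mapping.lookup \<alpha> i \<le> mlen \<alpha>"
  unfolding mlen_def by (rule member_le_sum) auto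

lemma finite_imp_mlen_bounded:
  assumes "finite F"
  obtains N where "F \<subseteq> {\<alpha>. mlen \<alpha> \<le> N}"
proof
  show "F \<subseteq> {\<alpha>. mlen \<alpha> \<le> (\<Sum>\<alpha>\<in>F. mlen \<alpha>)}"
    using member_le_sum[of _ F mlen] assms by auto
qed

subsection \<open>The smallest eigenvalue as a minimum of the Rayleigh quotient\<close>

definition form_on :: "'i set \<Rightarrow> ('i \<Rightarrow> 'i \<Rightarrow> complex) \<Rightarrow> ('i \<Rightarrow> complex) \<Rightarrow> complex" where
  "form_on I A v = (\<Sum>i\<in>I. \<Sum>j\<in>I. cnj (v i) * A i j * v j)"

lemma form_on_eigenvector:
  assumes "\<And>i. i \<in> I \<Longrightarrow> (\<Sum>j\<in>I. A i j * v j) = \<mu> * v i"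
  shows "form_on I A v = \<mu> * of_real (\<Sum>i\<in>I. (cmod (v i))\<^sup>2)"
proof -
  have *: "cnj x * (\<mu> * x) = \<mu> * of_real ((cmod x)\<^sup>2)" for x
    by (simp add: complex_norm_square ac_simps del: of_real_power)
  have "form_on I A v = (\<Sum>i\<in>I. cnj (v i) * (\<Sum>j\<in>I. A i j * v j))"
    unfolding form_on_def by (simp add: sum_distrib_left mult.assoc)
  also have "\<dots> = (\<Sum>i\<in>I. \<mu> * of_real ((cmod (v i))\<^sup>2))"
    by (intro sum.cong refl) (simp only: assms *)
  finally show ?thesis by (simp add: sum_distrib_left)
qed

text \<open>The unit sphere of the coordinates in \<open>I\<close> is compact and the form is
  continuous; homogeneity of degree two carries the bound from the sphere to every
  \<open>w\<close>.\<close>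

lemma form_on_attains_min:
  fixes A :: "'i \<Rightarrow> 'i \<Rightarrow> complex"
  assumes fin: "finite I" and ne: "I \<noteq> {}"
  obtains v where "(\<Sum>i\<in>I. (cmod (v i))\<^sup>2) = 1"
    "\<And>w. Re (form_on I A v) * (\<Sum>i\<in>I. (cmod (w i))\<^sup>2) \<le> Re (form_on I A w)"
proof -
  \<comment> \<open>The type \<open>'i\<close> may be infinite. Fixing the coordinates outside
    \<open>I\<close> to 0 makes \<open>B\<close> a product of compact sets, hence compact by
    Tychonoff.\<close>
  define B where "B = PiE UNIV (\<lambda>i. if i \<in> I then cball (0::complex) 1 else {0})"
  define S where "S = B \<inter> {v. (\<Sum>i\<in>I. (cmod (v i))\<^sup>2) = 1}"
  have "compactin (product_topology (\<lambda>i. euclidean) UNIV) B"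
    unfolding B_def compactin_PiE by auto
  then have "compact B" by (simp add: euclidean_product_topology)
  moreover have cont: "continuous_on X (\<lambda>x. x i)" for i and X :: "('i \<Rightarrow> complex) set"
    by (rule continuous_on_subset[OF continuous_on_product_coordinates]) simp
  have "closed {v::'i \<Rightarrow> complex. (\<Sum>i\<in>I. (cmod (v i))\<^sup>2) = 1}"
    by (intro closed_Collect_eq continuous_intros cont)
  ultimately have "compact S"
    unfolding S_def by (rule compact_Int_closed)
  have normalized: "(\<lambda>i. if i \<in> I then v i else 0) \<in> S" if v: "(\<Sum>i\<in>I. (cmod (v i))\<^sup>2) = 1" for v
  proof -
    have "cmod (v i) \<le> 1" if "i \<in> I" for i
      using member_le_sum[of i I "\<lambda>i. (cmod (v i))\<^sup>2"] that fin v
      by (simp add: power2_le_imp_le[of _ 1])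
    then show ?thesis using v by (auto simp: S_def B_def)
  qed
  have restrict: "form_on I A (\<lambda>i. if i \<in> I then v i else 0) = form_on I A v" for v
    by (simp add: form_on_def)
  obtain k where "k \<in> I" using ne by auto
  have "(\<Sum>i\<in>I. (cmod (if i = k then 1 else 0))\<^sup>2) = (\<Sum>i\<in>I. if i = k then 1 else 0 :: real)"
    by (intro sum.cong) auto
  with \<open>k \<in> I\<close> fin have "S \<noteq> {}"
    using normalized[of "\<lambda>i. if i = k then 1 else 0"] by auto
  moreover have "continuous_on S (\<lambda>v. Re (form_on I A v))"
    unfolding form_on_def by (intro continuous_intros cont)
  ultimately obtain v where v: "v \<in> S" and min: "\<And>w. w \<in> S \<Longrightarrow> Re (form_on I A v) \<le> Re (form_on I A w)"
    using continuous_attains_inf[OF \<open>compact S\<close>] by metis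
  show thesis
  proof
    show "(\<Sum>i\<in>I. (cmod (v i))\<^sup>2) = 1" using v by (simp add: S_def)
    fix w :: "'i \<Rightarrow> complex"
    define r where "r = sqrt (\<Sum>i\<in>I. (cmod (w i))\<^sup>2)"
    have r2: "r\<^sup>2 = (\<Sum>i\<in>I. (cmod (w i))\<^sup>2)"
      unfolding r_def by (simp add: sum_nonneg)
    show "Re (form_on I A v) * (\<Sum>i\<in>I. (cmod (w i))\<^sup>2) \<le> Re (form_on I A w)"
    proof (cases "r = 0")
      case True
      then have "\<forall>i\<in>I. w i = 0"
        using r2 fin by (simp add: sum_nonneg_eq_0_iff)
      then show ?thesis by (simp add: form_on_def)
    next
      case False
      define u where "u i = w i / of_real r" for i
      have "(\<Sum>i\<in>I. (cmod (u i))\<^sup>2) = 1"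
        using False by (simp add: u_def norm_divide power_divide flip: sum_divide_distrib r2)
      then have "Re (form_on I A v) \<le> Re (form_on I A u)"
        using min[OF normalized] restrict by metis
      also have "form_on I A u = form_on I A w / of_real (r\<^sup>2)"
        by (simp add: form_on_def u_def sum_divide_distrib power2_eq_square)
      finally show ?thesis
        using False by (simp add: r2[symmetric] Re_divide_of_real pos_le_divide_eq del: of_real_power)
    qed
  qed
qed

text \<open>A first variation argument: \<open>v\<close> is perturbed in the direction of its own
  residual \<open>g\<close>, that is, A v - m v. The derivative of the form minus \<open>m\<close>
  times the squared norm is then twice the squared norm \<open>a\<close> of \<open>g\<close>, and
  minimality forces it to vanish.\<close>

lemma form_on_minimizer_eigenvector:
  fixes A :: "'i \<Rightarrow> 'i \<Rightarrow> complex"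
  assumes fin: "finite I"
    and herm: "\<And>i j. i \<in> I \<Longrightarrow> j \<in> I \<Longrightarrow> A j i = cnj (A i j)"
    and v: "(\<Sum>i\<in>I. (cmod (v i))\<^sup>2) = 1"
    and min: "\<And>w. Re (form_on I A v) * (\<Sum>i\<in>I. (cmod (w i))\<^sup>2) \<le> Re (form_on I A w)"
    and "i \<in> I"
  shows "(\<Sum>j\<in>I. A i j * v j) = of_real (Re (form_on I A v)) * v i"
proof -
  define m where "m = Re (form_on I A v)"
  define g where "g i = (\<Sum>j\<in>I. A i j * v j) - of_real m * v i" for i
  define a where "a = (\<Sum>i\<in>I. (cmod (g i))\<^sup>2)"
  define b where "b = Re (form_on I A g) - m * a"
  have sq: "(cmod (x + of_real t * y))\<^sup>2 = (cmod x)\<^sup>2 + 2 * t * Re (cnj y * x) + t\<^sup>2 * (cmod y)\<^sup>2" for x y t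
    by (simp only: cmod_power2) (simp add: algebra_simps power2_eq_square)
  \<comment> \<open>The quadratic polynomial in \<open>t\<close> below is nonnegative, so its linear coefficient vanishes.\<close>
  have quad: "0 \<le> 2 * t * a + t\<^sup>2 * b" for t :: real
  proof -
    define w where "w i = v i + of_real t * g i" for i
    \<comment> \<open>Hermitian symmetry makes the two cross terms conjugate, so they have the same
      real part.\<close>
    have "(\<Sum>i\<in>I. \<Sum>j\<in>I. cnj (v i) * A i j * g j) = (\<Sum>j\<in>I. \<Sum>i\<in>I. cnj (v i) * A i j * g j)"
      by (rule sum.swap)
    also have "\<dots> = cnj (\<Sum>i\<in>I. \<Sum>j\<in>I. cnj (g i) * A i j * v j)"
      by (auto simp: intro!: sum.cong) (metis complex_cnj_cnj herm mult.commute mult.left_commute)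
    finally have cross: "Re (\<Sum>i\<in>I. \<Sum>j\<in>I. cnj (v i) * A i j * g j) = Re (\<Sum>i\<in>I. \<Sum>j\<in>I. cnj (g i) * A i j * v j)"
      by (simp only: cnj.sel)
    have "form_on I A w = form_on I A v + of_real t * (\<Sum>i\<in>I. \<Sum>j\<in>I. cnj (v i) * A i j * g j)
        + of_real t * (\<Sum>i\<in>I. \<Sum>j\<in>I. cnj (g i) * A i j * v j) + of_real (t\<^sup>2) * form_on I A g"
      unfolding form_on_def w_def sum_distrib_left sum.distrib[symmetric]
      by (intro sum.cong refl) (simp add: algebra_simps power2_eq_square)
    then have "Re (form_on I A w) = m + 2 * t * Re (\<Sum>i\<in>I. \<Sum>j\<in>I. cnj (g i) * A i j * v j) + t\<^sup>2 * Re (form_on I A g)"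
      using cross by (simp add: m_def del: of_real_power)
    moreover have "(\<Sum>i\<in>I. (cmod (w i))\<^sup>2) = 1 + 2 * t * Re (\<Sum>i\<in>I. cnj (g i) * v i) + t\<^sup>2 * a"
      unfolding w_def sq by (simp add: sum.distrib v a_def flip: sum_distrib_left)
    moreover have "m * (\<Sum>i\<in>I. (cmod (w i))\<^sup>2) \<le> Re (form_on I A w)"
      using min by (simp add: m_def)
    \<comment> \<open>The linear coefficient is the pairing of \<open>g\<close> with A v - m v,
      which is \<open>g\<close> itself.\<close>
    moreover have "Re (\<Sum>i\<in>I. \<Sum>j\<in>I. cnj (g i) * A i j * v j) - m * Re (\<Sum>i\<in>I. cnj (g i) * v i) = a"
    proof -
      have "cnj (g i) * g i = (\<Sum>j\<in>I. cnj (g i) * A i j * v j) - of_real m * (cnj (g i) * v i)" for i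
        by (subst (2) g_def) (simp add: right_diff_distrib sum_distrib_left ac_simps)
      then have "(\<Sum>i\<in>I. \<Sum>j\<in>I. cnj (g i) * A i j * v j) - of_real m * (\<Sum>i\<in>I. cnj (g i) * v i)
          = (\<Sum>i\<in>I. cnj (g i) * g i)"
        by (simp add: sum_subtractf sum_distrib_left)
      also have "\<dots> = of_real a"
        by (simp add: a_def complex_norm_square[symmetric] ac_simps del: of_real_power)
      finally have "Re (\<dots>) = Re ((\<Sum>i\<in>I. \<Sum>j\<in>I. cnj (g i) * A i j * v j) - of_real m * (\<Sum>i\<in>I. cnj (g i) * v i))"
        by simp
      then show ?thesis by simp
    qed
    ultimately show ?thesis
      by (simp add: b_def algebra_simps)
  qed
  have "a \<ge> 0" by (simp add: a_def sum_nonneg)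
  have "a = 0"
  proof (rule ccontr)
    assume "a \<noteq> 0"
    with \<open>a \<ge> 0\<close> have "a > 0" by simp
    \<comment> \<open>The size of \<open>t\<close> ensures |t b| \<le> a, so 2a + t b is at least
      \<open>a\<close>; its sign makes \<open>quad\<close> require 2a + t b \<le> 0.\<close>
    define t where "t = - a / (\<bar>b\<bar> + 1)"
    have "t < 0" using \<open>a > 0\<close> by (simp add: t_def divide_neg_pos)
    have "0 \<le> t * (2 * a + t * b)"
      using quad[of t] by (simp add: algebra_simps power2_eq_square)
    with \<open>t < 0\<close> have "2 * a + t * b \<le> 0"
      by (simp add: zero_le_mult_iff)
    moreover have "\<bar>t * b\<bar> \<le> a"
      using \<open>a > 0\<close> by (simp add: t_def abs_mult divide_simps mult_left_mono)
    ultimately show False using \<open>a > 0\<close> by linarith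
  qed
  then have "g i = 0"
    using fin \<open>i \<in> I\<close> by (simp add: a_def sum_nonneg_eq_0_iff)
  then show ?thesis by (simp add: g_def m_def)
qed

lemma orthonormal_family_card_le:
  fixes e :: "'t \<Rightarrow> 'i \<Rightarrow> complex"
  assumes "finite I" "finite F"
    and orth: "\<And>t u. t \<in> F \<Longrightarrow> u \<in> F \<Longrightarrow> (\<Sum>i\<in>I. cnj (e t i) * e u i) = (if t = u then 1 else 0)"
  shows "card F \<le> card I"
proof -
  \<comment> \<open>\<open>P\<close> is the matrix of the orthogonal projection onto the span of the family; its trace is
    \<open>card F\<close> and its diagonal entries are at most \<open>1\<close>.\<close>
  define P where "P i j = (\<Sum>t\<in>F. e t i * cnj (e t j))" for i j
  define d where "d i = (\<Sum>t\<in>F. (cmod (e t i))\<^sup>2)" for i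
  have diag: "P i i = of_real (d i)" for i
    by (simp add: P_def d_def complex_norm_square del: of_real_power)
  have "d i \<le> 1" if "i \<in> I" for i
  proof -
    \<comment> \<open>Inserting the Gram matrix of the family shows that \<open>P\<close> is
      idempotent on the diagonal. As \<open>P\<close> is Hermitian, \<open>d i\<close> is the
      squared norm of row \<open>i\<close>, which contains the term
      \<open>(d i)\<^sup>2\<close>.\<close>
    have "P i i = (\<Sum>t\<in>F. \<Sum>u\<in>F. e t i * cnj (e u i) * (\<Sum>j\<in>I. cnj (e t j) * e u j))"
      using \<open>finite F\<close> by (simp add: orth P_def if_distrib cong: if_cong)
    also have "\<dots> = (\<Sum>t\<in>F. \<Sum>u\<in>F. \<Sum>j\<in>I. (e t i * cnj (e t j)) * (e u j * cnj (e u i)))"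
      by (simp add: sum_distrib_left ac_simps)
    also have "\<dots> = (\<Sum>t\<in>F. \<Sum>j\<in>I. \<Sum>u\<in>F. (e t i * cnj (e t j)) * (e u j * cnj (e u i)))"
      by (intro sum.cong refl sum.swap)
    also have "\<dots> = (\<Sum>j\<in>I. \<Sum>t\<in>F. \<Sum>u\<in>F. (e t i * cnj (e t j)) * (e u j * cnj (e u i)))"
      by (rule sum.swap)
    also have "\<dots> = (\<Sum>j\<in>I. P i j * P j i)"
      by (simp add: P_def sum_product)
    also have "\<dots> = (\<Sum>j\<in>I. P i j * cnj (P i j))"
      by (simp add: P_def mult.commute)
    also have "\<dots> = of_real (\<Sum>j\<in>I. (cmod (P i j))\<^sup>2)"
      by (simp add: complex_norm_square del: of_real_power)
    finally have "d i = (\<Sum>j\<in>I. (cmod (P i j))\<^sup>2)"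
      by (simp only: diag of_real_eq_iff)
    moreover have "(d i)\<^sup>2 \<le> (\<Sum>j\<in>I. (cmod (P i j))\<^sup>2)"
      using member_le_sum[of i I "\<lambda>j. (cmod (P i j))\<^sup>2"] that \<open>finite I\<close> by (simp add: diag)
    ultimately have "d i * d i \<le> d i * 1" by (simp add: power2_eq_square)
    moreover have "0 \<le> d i" by (simp add: d_def sum_nonneg)
    ultimately show ?thesis
      by (cases "d i = 0") (simp_all add: mult_le_cancel_left)
  qed
  then have "(\<Sum>i\<in>I. d i) \<le> of_nat (card I) * 1"
    by (rule sum_bounded_above)
  moreover have "(\<Sum>i\<in>I. (cmod (e t i))\<^sup>2) = 1" if "t \<in> F" for t
  proof -
    have "of_real (\<Sum>i\<in>I. (cmod (e t i))\<^sup>2) = (\<Sum>i\<in>I. cnj (e t i) * e t i)"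
      by (simp add: complex_norm_square ac_simps del: of_real_power)
    also have "\<dots> = of_real 1" using orth[OF that that] by simp
    finally show ?thesis by (simp only: of_real_eq_iff)
  qed
  \<comment> \<open>Summed vector by vector instead, the trace counts one for each unit
    vector.\<close>
  then have "(\<Sum>i\<in>I. d i) = of_nat (card F)"
    unfolding d_def by (subst sum.swap) simp
  ultimately show ?thesis by simp
qed

text \<open>Unit eigenvectors for distinct real eigenvalues are orthonormal, so there are at most
  \<open>card I\<close> of them. Finiteness gives the \<open>Min\<close> in
  \<open>min_eigenvalue\<close> its intended meaning.\<close>

lemma finite_real_eigenvalues:
  assumes fin: "finite I"
    and herm: "\<And>i j. i \<in> I \<Longrightarrow> j \<in> I \<Longrightarrow> A j i = cnj (A i j)"
  shows "finite {t::real. eigenvalue_on I A (of_real t)}" (is "finite ?T")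
proof -
  have "\<exists>v. (\<Sum>i\<in>I. (cmod (v i))\<^sup>2) = 1 \<and> (\<forall>i\<in>I. (\<Sum>j\<in>I. A i j * v j) = of_real t * v i)"
    if "t \<in> ?T" for t
  proof -
    from that obtain v k where k: "k \<in> I" "v k \<noteq> 0"
      and v: "\<And>i. i \<in> I \<Longrightarrow> (\<Sum>j\<in>I. A i j * v j) = of_real t * v i"
      unfolding eigenvalue_on_def by auto
    define r where "r = sqrt (\<Sum>i\<in>I. (cmod (v i))\<^sup>2)"
    have "(\<Sum>i\<in>I. (cmod (v i))\<^sup>2) > 0"
      by (rule sum_pos2[OF fin k(1)]) (use k in auto)
    then have "r > 0" and r2: "(\<Sum>i\<in>I. (cmod (v i))\<^sup>2) = r\<^sup>2" by (auto simp: r_def)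
    then have "(\<Sum>i\<in>I. (cmod (v i / of_real r))\<^sup>2) = 1"
      by (simp add: norm_divide power_divide r2 flip: sum_divide_distrib)
    moreover have "(\<Sum>j\<in>I. A i j * (v j / of_real r)) = of_real t * (v i / of_real r)" if "i \<in> I" for i
      using v[OF that] by (simp flip: sum_divide_distrib)
    ultimately show ?thesis by (intro exI[of _ "\<lambda>i. v i / of_real r"]) auto
  qed
  then obtain e where e1: "\<And>t. t \<in> ?T \<Longrightarrow> (\<Sum>i\<in>I. (cmod (e t i))\<^sup>2) = 1"
    and e2: "\<And>t i. t \<in> ?T \<Longrightarrow> i \<in> I \<Longrightarrow> (\<Sum>j\<in>I. A i j * e t j) = of_real t * e t i"
    by metis
  have orth: "(\<Sum>i\<in>I. cnj (e t i) * e u i) = (if t = u then 1 else 0)"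
    if tu: "t \<in> ?T" "u \<in> ?T" for t u
  proof (cases "t = u")
    case True
    have "(\<Sum>i\<in>I. cnj (e t i) * e t i) = of_real (\<Sum>i\<in>I. (cmod (e t i))\<^sup>2)"
      by (simp add: complex_norm_square ac_simps del: of_real_power)
    with e1 tu True show ?thesis by simp
  next
    case False
    \<comment> \<open>The matrix is moved from the eigenvector of \<open>u\<close> to that of
      \<open>t\<close>; the inner product times \<open>u\<close> then equals itself times
      \<open>t\<close>.\<close>
    have "of_real u * (\<Sum>i\<in>I. cnj (e t i) * e u i) = (\<Sum>i\<in>I. cnj (e t i) * (of_real u * e u i))"
      by (simp add: sum_distrib_left ac_simps)
    also have "\<dots> = (\<Sum>i\<in>I. \<Sum>j\<in>I. cnj (e t i) * (A i j * e u j))"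
      using e2[OF tu(2)] by (simp flip: sum_distrib_left)
    also have "\<dots> = (\<Sum>j\<in>I. \<Sum>i\<in>I. cnj (e t i) * (A i j * e u j))"
      by (rule sum.swap)
    also have "\<dots> = (\<Sum>j\<in>I. cnj (\<Sum>i\<in>I. A j i * e t i) * e u j)"
      unfolding cnj_sum sum_distrib_right
      by (intro sum.cong refl) (simp add: herm[symmetric] ac_simps)
    also have "\<dots> = of_real t * (\<Sum>i\<in>I. cnj (e t i) * e u i)"
      by (simp add: e2[OF tu(1)] sum_distrib_left ac_simps)
    finally show ?thesis using False by simp
  qed
  have "finite ?T \<and> card ?T \<le> card I"
    by (rule finite_if_finite_subsets_card_bdd)
       (use orthonormal_family_card_le[OF fin] orth in blast)
  then show ?thesis ..
qed

text \<open>The minimum of the form on the unit sphere is an eigenvalue, and testing the minimality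
  with any other eigenvector shows that no eigenvalue lies below it.\<close>

lemma Min_eigenvalue_rayleigh:
  fixes A :: "'i \<Rightarrow> 'i \<Rightarrow> complex"
  assumes "finite I" "I \<noteq> {}"
    and herm: "\<And>i j. i \<in> I \<Longrightarrow> j \<in> I \<Longrightarrow> A j i = cnj (A i j)"
  defines "m \<equiv> Min {t. eigenvalue_on I A (of_real t)}"
  obtains v where "(\<Sum>i\<in>I. (cmod (v i))\<^sup>2) = 1" "Re (form_on I A v) = m"
    "\<And>w. m * (\<Sum>i\<in>I. (cmod (w i))\<^sup>2) \<le> Re (form_on I A w)"
proof -
  obtain v where v: "(\<Sum>i\<in>I. (cmod (v i))\<^sup>2) = 1"
    and min: "\<And>w. Re (form_on I A v) * (\<Sum>i\<in>I. (cmod (w i))\<^sup>2) \<le> Re (form_on I A w)"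
    using form_on_attains_min[OF assms(1,2)] by metis
  have "\<exists>i\<in>I. v i \<noteq> 0"
  proof (rule ccontr)
    assume "\<not> ?thesis"
    then have "(\<Sum>i\<in>I. (cmod (v i))\<^sup>2) = 0" by simp
    with v show False by simp
  qed
  then have "eigenvalue_on I A (of_real (Re (form_on I A v)))"
    unfolding eigenvalue_on_def
    using form_on_minimizer_eigenvector[OF assms(1) herm v min] by blast
  moreover have "Re (form_on I A v) \<le> t" if t: "eigenvalue_on I A (of_real t)" for t
  proof -
    from t obtain w k where k: "k \<in> I" "w k \<noteq> 0"
      and w: "\<And>i. i \<in> I \<Longrightarrow> (\<Sum>j\<in>I. A i j * w j) = of_real t * w i"
      unfolding eigenvalue_on_def by auto
    have "(\<Sum>i\<in>I. (cmod (w i))\<^sup>2) > 0"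
      by (rule sum_pos2[OF assms(1) k(1)]) (use k in auto)
    moreover have "form_on I A w = of_real t * of_real (\<Sum>i\<in>I. (cmod (w i))\<^sup>2)"
      by (rule form_on_eigenvector) (rule w)
    then have "Re (form_on I A w) = t * (\<Sum>i\<in>I. (cmod (w i))\<^sup>2)"
      by (simp only: of_real_mult[symmetric] Re_complex_of_real)
    ultimately show ?thesis using min[of w] by simp
  qed
  ultimately have "m = Re (form_on I A v)"
    unfolding m_def by (intro Min_eqI finite_real_eigenvalues assms) auto
  then show thesis using that v min by simp
qed

section \<open>The weighted coefficient norm and the limit of the smallest eigenvalues\<close>

text \<open>This is a squared norm: the Euclidean one of the rescaled coefficient vector, and the
  mean of |p|^2 over the torus of radius \<open>R\<close>.\<close>

definition weight_norm :: "real \<Rightarrow> ('d::finite) cpoly \<Rightarrow> real" where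
  "weight_norm R p = (\<Sum>\<alpha>\<in>Poly_Mapping.keys p. (cmod (coef p \<alpha>) * R ^ mlen \<alpha>)\<^sup>2)"

lemma weight_norm_superset:
  assumes "finite A" "Poly_Mapping.keys p \<subseteq> A"
  shows "weight_norm R p = (\<Sum>\<alpha>\<in>A. (cmod (coef p \<alpha>) * R ^ mlen \<alpha>)\<^sup>2)"
  unfolding weight_norm_def using assms
  by (intro sum.mono_neutral_left) (auto simp: in_keys_iff)

text \<open>The factors R^|\<alpha>| and R^|\<beta>| cancel the denominator of the matrix entry. The
  conjugate on the coefficients makes the terms agree with those of \<open>ip_expand\<close> one by
  one.\<close>

lemma form_on_hankel:
  assumes "R \<noteq> 0" "Poly_Mapping.keys p \<subseteq> {\<alpha>. mlen \<alpha> \<le> N}"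
  shows "form_on {\<alpha>. mlen \<alpha> \<le> N} (hankel s R) (\<lambda>\<alpha>. cnj (coef p \<alpha>) * of_real (R ^ mlen \<alpha>)) = ip s p p"
  using assms
  by (subst ip_expand[OF finite_mlen_le assms(2) finite_mlen_le assms(2)])
     (auto simp: form_on_def hankel_def mlen_add power_add intro!: sum.cong)

text \<open>The Rayleigh principle for the matrix, rewritten for polynomials by
  \<open>form_on_hankel\<close>. The matrix is Hermitian because \<open>s\<close> is real and
  \<alpha> + \<beta> is symmetric.\<close>

lemma min_eigenvalue_rayleigh:
  assumes "pos_multiseq s" "R > 0"
  shows "\<exists>p. Poly_Mapping.keys p \<subseteq> {\<alpha>. mlen \<alpha> \<le> N} \<and> weight_norm R p = 1
           \<and> Re (ip s p p) = min_eigenvalue s R N" (is ?attained)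
    and "Poly_Mapping.keys p \<subseteq> {\<alpha>. mlen \<alpha> \<le> N} \<Longrightarrow> min_eigenvalue s R N * weight_norm R p \<le> Re (ip s p p)"
      (is "?keys \<Longrightarrow> ?bound")
proof -
  let ?I = "{\<alpha> :: 'a mindex. mlen \<alpha> \<le> N}"
  have "0 \<in> ?I" by (simp add: mlen_def)
  then have "?I \<noteq> {}" by blast
  then obtain v where v: "(\<Sum>\<alpha>\<in>?I. (cmod (v \<alpha>))\<^sup>2) = 1"
      "Re (form_on ?I (hankel s R) v) = min_eigenvalue s R N"
    and bound: "\<And>w. min_eigenvalue s R N * (\<Sum>\<alpha>\<in>?I. (cmod (w \<alpha>))\<^sup>2) \<le> Re (form_on ?I (hankel s R) w)"
    unfolding min_eigenvalue_def
    by (rule Min_eigenvalue_rayleigh[OF finite_mlen_le, of N "hankel s R"])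
       (auto simp: hankel_def pos_multiseq_real[OF assms(1)] add.commute)
  show ?attained
  proof -
    \<comment> \<open>Undoing the rescaling turns the minimising vector into a polynomial.\<close>
    define p where "p = (\<Sum>\<alpha>\<in>?I. Poly_Mapping.single \<alpha> (cnj (v \<alpha>) / of_real (R ^ mlen \<alpha>)))"
    have p: "coef p \<alpha> = (if \<alpha> \<in> ?I then cnj (v \<alpha>) / of_real (R ^ mlen \<alpha>) else 0)" for \<alpha>
      unfolding p_def by (rule coef_sum_single[OF finite_mlen_le])
    have keys: "Poly_Mapping.keys p \<subseteq> ?I"
      by (auto simp: in_keys_iff p split: if_splits)
    have "form_on ?I (hankel s R) (\<lambda>\<alpha>. cnj (coef p \<alpha>) * of_real (R ^ mlen \<alpha>)) = form_on ?I (hankel s R) v"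
      using assms(2) by (simp add: form_on_def p)
    then have "ip s p p = form_on ?I (hankel s R) v"
      using form_on_hankel[OF _ keys] assms(2) by simp
    moreover have "weight_norm R p = (\<Sum>\<alpha>\<in>?I. (cmod (v \<alpha>))\<^sup>2)"
      unfolding weight_norm_superset[OF finite_mlen_le keys]
      using assms(2) by (intro sum.cong) (auto simp: p norm_divide norm_power)
    ultimately show ?thesis using keys v by auto
  qed
  show ?bound if keys: ?keys
  proof -
    have "R \<noteq> 0" using assms(2) by simp
    have eq: "weight_norm R p = (\<Sum>\<alpha>\<in>?I. (cmod (cnj (coef p \<alpha>) * of_real (R ^ mlen \<alpha>)))\<^sup>2)"
      unfolding weight_norm_superset[OF finite_mlen_le keys]
      using assms(2) by (intro sum.cong) (auto simp: norm_mult norm_power)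
    show ?thesis
      unfolding eq by (rule bound[of "\<lambda>\<alpha>. cnj (coef p \<alpha>) * of_real (R ^ mlen \<alpha>)",
            unfolded form_on_hankel[OF \<open>R \<noteq> 0\<close> keys]])
  qed
qed

text \<open>The limit of the decreasing eigenvalues lies below all of them, so it serves as
  \<epsilon> itself; conversely every admissible \<epsilon> is a lower bound of the eigenvalues and
  so of their limit.\<close>

lemma gamma_lim_pos_iff:
  assumes "pos_multiseq s" "R > 0"
  shows "gamma_lim s R > 0 \<longleftrightarrow> (\<exists>\<epsilon>>0. \<forall>p. \<epsilon> * weight_norm R p \<le> Re (ip s p p))"
proof -
  let ?l = "min_eigenvalue s R"
  note attained = min_eigenvalue_rayleigh(1)[OF assms] and bound = min_eigenvalue_rayleigh(2)[OF assms]
  have dec: "decseq ?l"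
  proof (rule decseq_SucI)
    fix N
    \<comment> \<open>A minimiser for \<open>N\<close> is admissible for
      \<open>Suc N\<close>.\<close>
    obtain p where "Poly_Mapping.keys p \<subseteq> {\<alpha>. mlen \<alpha> \<le> N}" "weight_norm R p = 1" "Re (ip s p p) = ?l N"
      using attained by blast
    then show "?l (Suc N) \<le> ?l N"
      using bound[of p "Suc N"] by force
  qed
  \<comment> \<open>The lower bound gives convergence, which is what makes the \<open>lim\<close> in
    \<open>gamma_lim\<close> an actual limit.\<close>
  have "0 \<le> ?l N" for N
    using attained[of N] pos_multiseq_ip(2)[OF assms(1)] by metis
  then obtain L where "?l \<longlonglongrightarrow> L"
    using decseq_convergent[OF dec, of 0] by blast
  then have lim: "?l \<longlonglongrightarrow> gamma_lim s R"
    by (simp add: gamma_lim_def limI)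
  show ?thesis
  proof
    assume "gamma_lim s R > 0"
    moreover have "gamma_lim s R * weight_norm R p \<le> Re (ip s p p)" for p
    proof -
      obtain N where "Poly_Mapping.keys p \<subseteq> {\<alpha>. mlen \<alpha> \<le> N}"
        using finite_imp_mlen_bounded[OF finite_keys] .
      then have "?l N * weight_norm R p \<le> Re (ip s p p)" by (rule bound)
      moreover have "weight_norm R p \<ge> 0" by (simp add: weight_norm_def sum_nonneg)
      ultimately show ?thesis
        using mult_right_mono[OF decseq_ge[OF dec lim, of N]] by force
    qed
    ultimately show "\<exists>\<epsilon>>0. \<forall>p. \<epsilon> * weight_norm R p \<le> Re (ip s p p)" by blast
  next
    assume "\<exists>\<epsilon>>0. \<forall>p. \<epsilon> * weight_norm R p \<le> Re (ip s p p)"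
    then obtain \<epsilon> where "\<epsilon> > 0" and eps: "\<And>p. \<epsilon> * weight_norm R p \<le> Re (ip s p p)" by blast
    have "\<epsilon> \<le> ?l N" for N
      using attained[of N] eps by (metis mult.right_neutral)
    then have "\<epsilon> \<le> gamma_lim s R"
      using LIMSEQ_le_const[OF lim] by blast
    with \<open>\<epsilon> > 0\<close> show "gamma_lim s R > 0" by simp
  qed
qed

subsection \<open>Gram--Schmidt and the kernel\<close>

text \<open>This supplies \<open>span\<close> for polynomials, used to expand them in the
  orthonormal system.\<close>

interpretation cpoly: vector_space scale_poly
  by unfold_locales (auto intro!: poly_mapping_eqI simp: lookup_add algebra_simps)

lemma grlex_less_irrefl: "\<not> grlex_less \<alpha> \<alpha>"
  by (simp add: grlex_less_def)

lemma grlex_less_linear: "grlex_less \<alpha> \<beta> \<or> \<alpha> = \<beta> \<or> grlex_less \<beta> \<alpha>"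
  by (auto simp: grlex_less_def)

lemma grlex_less_trans: "grlex_less \<alpha> \<beta> \<Longrightarrow> grlex_less \<beta> \<gamma> \<Longrightarrow> grlex_less \<alpha> \<gamma>"
  by (auto simp: grlex_less_def)

text \<open>Every multi-index has finitely many predecessors, and their number strictly increases
  along the order.\<close>

lemma grlex_induct:
  assumes "\<And>\<alpha>. (\<And>\<beta>. grlex_less \<beta> \<alpha> \<Longrightarrow> P \<beta>) \<Longrightarrow> P \<alpha>"
  shows "P \<alpha>"
  by (induction \<alpha> rule: measure_induct_rule[of "\<lambda>\<alpha>. card {\<beta>. grlex_less \<beta> \<alpha>}"])
     (blast intro: assms grlex_less_card)

text \<open>Gram-Schmidt before normalisation, kept apart because its leading coefficient is 1 and
  it is therefore never zero.\<close>

definition gs_residual :: "(('d::{finite,linorder}) mindex \<Rightarrow> complex) \<Rightarrow> 'd mindex \<Rightarrow> 'd cpoly" where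
  "gs_residual s \<alpha> = monom_poly \<alpha> -
     (\<Sum>\<beta>\<in>{\<beta>. grlex_less \<beta> \<alpha>}. scale_poly (ip s (monom_poly \<alpha>) (orth_poly s \<beta>)) (orth_poly s \<beta>))"

lemma orth_poly_eq: "orth_poly s \<alpha> = normalize_poly s (gs_residual s \<alpha>)"
  unfolding gs_residual_def by (rule orth_poly.simps)

lemma coef_orth_poly_eq_0: "grlex_less \<alpha> \<beta> \<Longrightarrow> coef (orth_poly s \<alpha>) \<beta> = 0"
proof (induction \<alpha> arbitrary: \<beta> rule: grlex_induct)
  case (1 \<alpha>)
  have "coef (orth_poly s \<gamma>) \<beta> = 0" if "grlex_less \<gamma> \<alpha>" for \<gamma>
    using 1(1)[OF that grlex_less_trans[OF that 1(2)]] .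
  moreover have "\<alpha> \<noteq> \<beta>" using 1(2) by (auto simp: grlex_less_irrefl)
  ultimately show ?case
    by (simp add: orth_poly_eq[of s \<alpha>] gs_residual_def normalize_poly_def monom_poly_def lookup_minus
        lookup_sum lookup_single)
qed

lemma gs_residual_nonzero: "gs_residual s \<alpha> \<noteq> 0"
proof -
  have "coef (gs_residual s \<alpha>) \<alpha> = 1"
    by (simp add: gs_residual_def monom_poly_def lookup_minus lookup_sum coef_orth_poly_eq_0)
  then show ?thesis by auto
qed

lemma cauchy_schwarz_sum_norm:
  fixes f g :: "'i \<Rightarrow> complex"
  shows "(cmod (\<Sum>i\<in>I. f i * g i))\<^sup>2 \<le> (\<Sum>i\<in>I. (cmod (f i))\<^sup>2) * (\<Sum>i\<in>I. (cmod (g i))\<^sup>2)"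
proof -
  have "cmod (\<Sum>i\<in>I. f i * g i) \<le> (\<Sum>i\<in>I. cmod (f i) * cmod (g i))"
    by (rule sum_norm_le) (simp add: norm_mult)
  then have "(cmod (\<Sum>i\<in>I. f i * g i))\<^sup>2 \<le> (\<Sum>i\<in>I. cmod (f i) * cmod (g i))\<^sup>2"
    by (rule power_mono) simp
  also have "\<dots> \<le> (\<Sum>i\<in>I. (cmod (f i))\<^sup>2) * (\<Sum>i\<in>I. (cmod (g i))\<^sup>2)"
    by (rule Cauchy_Schwarz_ineq_sum)
  finally show ?thesis .
qed

text \<open>Positive definiteness makes the normalising factors of Gram-Schmidt finite and positive.
  In the theorem it comes from the positive eigenvalues at a single radius.\<close>

locale posdef_multiseq =
  fixes s :: "('d::{finite,linorder}) mindex \<Rightarrow> complex"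
  assumes pos: "pos_multiseq s"
    and posdef: "p \<noteq> 0 \<Longrightarrow> 0 < Re (ip s p p)"
begin

lemma ip_self: "ip s p p = of_real (Re (ip s p p))"
  by (simp add: complex_eq_iff pos_multiseq_ip(1)[OF pos])

lemma ip_normalize_self:
  assumes "q \<noteq> 0"
  shows "ip s (normalize_poly s q) (normalize_poly s q) = 1"
proof -
  define r where "r = sqrt (Re (ip s q q))"
  have "r > 0" using posdef[OF assms] by (simp add: r_def)
  have "ip s q q = of_real (r\<^sup>2)"
    using posdef[OF assms] by (subst ip_self) (simp add: r_def)
  with \<open>r > 0\<close> show ?thesis
    unfolding normalize_poly_def r_def[symmetric] by (simp add: power2_eq_square)
qed

text \<open>The induction covers earlier indices only; \<open>ip_commute\<close> extends
  orthogonality to the reversed order.\<close>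

lemma ip_orth_poly_below:
  "ip s (orth_poly s \<alpha>) (orth_poly s \<alpha>) = 1 \<and>
   (\<forall>\<gamma>. grlex_less \<gamma> \<alpha> \<longrightarrow> ip s (orth_poly s \<alpha>) (orth_poly s \<gamma>) = 0)"
proof (induction \<alpha> rule: grlex_induct)
  case (1 \<alpha>)
  have IH: "ip s (orth_poly s \<beta>) (orth_poly s \<gamma>) = (if \<beta> = \<gamma> then 1 else 0)"
    if "grlex_less \<beta> \<alpha>" "grlex_less \<gamma> \<alpha>" for \<beta> \<gamma>
    using 1[OF that(1)] 1[OF that(2)] grlex_less_linear[of \<beta> \<gamma>]
      ip_commute[OF pos, of "orth_poly s \<beta>" "orth_poly s \<gamma>"] by auto
  \<comment> \<open>By the induction hypothesis only the term of \<gamma> survives in the projection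
    sum, and it cancels the contribution of the monomial.\<close>
  have "ip s (gs_residual s \<alpha>) (orth_poly s \<gamma>) = 0" if "grlex_less \<gamma> \<alpha>" for \<gamma>
    using that finite_grlex_below[of \<alpha>]
    by (simp add: gs_residual_def ip_diff_left ip_sum_left IH if_distrib cong: if_cong)
  then show ?case
    using ip_normalize_self[OF gs_residual_nonzero[of s \<alpha>]]
    by (simp add: orth_poly_eq[of s \<alpha>]) (simp add: normalize_poly_def)
qed

lemma ip_orth_poly: "ip s (orth_poly s \<alpha>) (orth_poly s \<beta>) = (if \<alpha> = \<beta> then 1 else 0)"
  using ip_orth_poly_below[of \<alpha>] ip_orth_poly_below[of \<beta>] grlex_less_linear[of \<alpha> \<beta>]
    ip_commute[OF pos, of "orth_poly s \<alpha>" "orth_poly s \<beta>"] by auto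

lemma inj_orth_poly: "inj (orth_poly s)"
proof (rule injI)
  fix \<alpha> \<beta>
  assume "orth_poly s \<alpha> = orth_poly s \<beta>"
  then show "\<alpha> = \<beta>"
    using ip_orth_poly[of \<alpha> \<beta>] ip_orth_poly[of \<beta> \<beta>] by (auto split: if_splits)
qed

text \<open>The Gram-Schmidt step is solved for the monomial, the residual being a multiple of
  \<open>orth_poly s \<alpha>\<close>.\<close>

lemma monom_poly_in_span: "monom_poly \<alpha> \<in> cpoly.span (range (orth_poly s))"
proof -
  define r where "r = sqrt (Re (ip s (gs_residual s \<alpha>) (gs_residual s \<alpha>)))"
  have "r > 0" using posdef[OF gs_residual_nonzero] by (simp add: r_def)
  then have "gs_residual s \<alpha> = scale_poly (of_real r) (orth_poly s \<alpha>)"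
    unfolding orth_poly_eq[of s \<alpha>] normalize_poly_def r_def[symmetric] by simp
  moreover have "monom_poly \<alpha> = gs_residual s \<alpha> +
     (\<Sum>\<beta>\<in>{\<beta>. grlex_less \<beta> \<alpha>}. scale_poly (ip s (monom_poly \<alpha>) (orth_poly s \<beta>)) (orth_poly s \<beta>))"
    by (simp add: gs_residual_def)
  moreover have "scale_poly c (orth_poly s \<beta>) \<in> cpoly.span (range (orth_poly s))" for c \<beta>
    by (intro cpoly.span_scale cpoly.span_base) simp
  ultimately show ?thesis
    by (metis (no_types, lifting) cpoly.span_add cpoly.span_sum)
qed

lemma orth_poly_expansion:
  obtains F c where "finite F" "p = (\<Sum>\<alpha>\<in>F. scale_poly (c \<alpha>) (orth_poly s \<alpha>))"
proof -
  have "scale_poly c (monom_poly \<alpha>) = Poly_Mapping.single \<alpha> c" for c and \<alpha> :: "'d mindex"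
    by (rule poly_mapping_eqI) (simp add: monom_poly_def lookup_single when_def)
  then have "p = (\<Sum>\<alpha>\<in>Poly_Mapping.keys p. scale_poly (coef p \<alpha>) (monom_poly \<alpha>))"
    using poly_eq_sum_single[of "Poly_Mapping.keys p" p] by simp
  also have "\<dots> \<in> cpoly.span (range (orth_poly s))"
    by (intro cpoly.span_sum cpoly.span_scale monom_poly_in_span)
  finally obtain T r where T: "finite T" "T \<subseteq> range (orth_poly s)" "p = (\<Sum>q\<in>T. scale_poly (r q) q)"
    unfolding cpoly.span_explicit by blast
  \<comment> \<open>Injectivity of \<open>orth_poly s\<close> allows the spanning polynomials to be
    reindexed by multi-indices.\<close>
  then obtain F where F: "T = orth_poly s ` F" by (auto simp: subset_image_iff)
  have inj: "inj_on (orth_poly s) F" using inj_orth_poly by (rule inj_on_subset) simp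
  have "finite F" using T(1) inj unfolding F by (rule finite_imageD)
  moreover have "p = (\<Sum>\<alpha>\<in>F. scale_poly (r (orth_poly s \<alpha>)) (orth_poly s \<alpha>))"
    using T(3) unfolding F by (simp add: sum.reindex[OF inj])
  ultimately show thesis by (rule that)
qed

lemma ip_self_expansion:
  assumes "finite F"
  shows "Re (ip s (\<Sum>\<alpha>\<in>F. scale_poly (c \<alpha>) (orth_poly s \<alpha>)) (\<Sum>\<alpha>\<in>F. scale_poly (c \<alpha>) (orth_poly s \<alpha>)))
           = (\<Sum>\<alpha>\<in>F. (cmod (c \<alpha>))\<^sup>2)"
proof -
  have "ip s (\<Sum>\<alpha>\<in>F. scale_poly (c \<alpha>) (orth_poly s \<alpha>)) (\<Sum>\<alpha>\<in>F. scale_poly (c \<alpha>) (orth_poly s \<alpha>))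
      = (\<Sum>\<alpha>\<in>F. c \<alpha> * cnj (c \<alpha>))"
    using assms by (simp add: ip_sum_left ip_sum_right ip_orth_poly if_distrib mult.commute cong: if_cong)
  also have "\<dots> = of_real (\<Sum>\<alpha>\<in>F. (cmod (c \<alpha>))\<^sup>2)"
    by (simp add: complex_norm_square del: of_real_power)
  finally show ?thesis by (simp only: Re_complex_of_real)
qed

lemma eval_poly_expansion:
  "eval_poly (\<Sum>\<alpha>\<in>F. scale_poly (c \<alpha>) (orth_poly s \<alpha>)) z = (\<Sum>\<alpha>\<in>F. c \<alpha> * eval_poly (orth_poly s \<alpha>) z)"
  by (simp add: eval_poly_eq_riesz riesz_sum riesz_scale)

text \<open>One direction is Cauchy-Schwarz in orthonormal coordinates; the other tests the
  inequality with the truncated kernel. The constant is the same on both sides.\<close>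

lemma kernel_bound_iff:
  assumes "M \<ge> 0"
  shows "(\<forall>F. finite F \<longrightarrow> (\<Sum>\<alpha>\<in>F. (cmod (eval_poly (orth_poly s \<alpha>) z))\<^sup>2) \<le> M)
     \<longleftrightarrow> (\<forall>p. (cmod (eval_poly p z))\<^sup>2 \<le> M * Re (ip s p p))"
proof (intro iffI allI impI)
  fix p
  assume bound: "\<forall>F. finite F \<longrightarrow> (\<Sum>\<alpha>\<in>F. (cmod (eval_poly (orth_poly s \<alpha>) z))\<^sup>2) \<le> M"
  obtain F c where F: "finite F" "p = (\<Sum>\<alpha>\<in>F. scale_poly (c \<alpha>) (orth_poly s \<alpha>))"
    by (rule orth_poly_expansion)
  have "(cmod (eval_poly p z))\<^sup>2 \<le> (\<Sum>\<alpha>\<in>F. (cmod (c \<alpha>))\<^sup>2) * (\<Sum>\<alpha>\<in>F. (cmod (eval_poly (orth_poly s \<alpha>) z))\<^sup>2)"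
    unfolding F(2) eval_poly_expansion by (rule cauchy_schwarz_sum_norm)
  also have "\<dots> \<le> (\<Sum>\<alpha>\<in>F. (cmod (c \<alpha>))\<^sup>2) * M"
    using bound F(1) by (intro mult_left_mono sum_nonneg) auto
  finally show "(cmod (eval_poly p z))\<^sup>2 \<le> M * Re (ip s p p)"
    unfolding F(2) ip_self_expansion[OF F(1)] by (simp add: mult.commute)
next
  fix F :: "'d mindex set"
  assume bound: "\<forall>p. (cmod (eval_poly p z))\<^sup>2 \<le> M * Re (ip s p p)" and "finite F"
  define S where "S = (\<Sum>\<alpha>\<in>F. (cmod (eval_poly (orth_poly s \<alpha>) z))\<^sup>2)"
  \<comment> \<open>The truncated kernel at \<open>z\<close>: both its value at \<open>z\<close> and its squared norm are \<open>S\<close>.\<close>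
  define p where "p = (\<Sum>\<alpha>\<in>F. scale_poly (cnj (eval_poly (orth_poly s \<alpha>) z)) (orth_poly s \<alpha>))"
  have "eval_poly p z = of_real S"
    unfolding p_def eval_poly_expansion S_def
    by (simp add: complex_norm_square mult.commute del: of_real_power)
  moreover have "Re (ip s p p) = S"
    unfolding p_def ip_self_expansion[OF \<open>finite F\<close>] S_def by simp
  ultimately have "S * S \<le> M * S"
    using bound[rule_format, of p] by (simp add: power2_eq_square)
  moreover have "S \<ge> 0" by (simp add: S_def sum_nonneg)
  ultimately have "S \<le> M" using assms by (cases "S = 0") (auto simp: mult_le_cancel_right)
  then show "(\<Sum>\<alpha>\<in>F. (cmod (eval_poly (orth_poly s \<alpha>) z))\<^sup>2) \<le> M" by (simp add: S_def)
qed

end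

subsection \<open>Weighted coefficient norms and point evaluations\<close>

text \<open>Enlarging \<open>F\<close> to a box turns the sum into a product of finite geometric
  sums, one for each variable.\<close>

lemma sum_power_mlen_le:
  fixes q :: real and F :: "('d::finite) mindex set"
  assumes "finite F" "0 \<le> q" "q < 1"
  shows "(\<Sum>\<alpha>\<in>F. q ^ mlen \<alpha>) \<le> (1 / (1 - q)) ^ CARD('d)"
proof -
  obtain N where "F \<subseteq> {\<alpha>. mlen \<alpha> \<le> N}"
    using finite_imp_mlen_bounded[OF assms(1)] .
  then have N: "Poly_Mapping.lookup \<alpha> i \<le> N" if "\<alpha> \<in> F" for \<alpha> i
    using that lookup_le_mlen[of \<alpha> i] by fastforce
  have "(\<Sum>\<alpha>\<in>F. q ^ mlen \<alpha>) = (\<Sum>\<alpha>\<in>F. \<Prod>i\<in>UNIV. q ^ Poly_Mapping.lookup \<alpha> i)"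
    by (simp add: mlen_def power_sum)
  also have "\<dots> = (\<Sum>f\<in>Poly_Mapping.lookup ` F. \<Prod>i\<in>UNIV. q ^ f i)"
    by (subst sum.reindex) (auto simp: inj_on_def Poly_Mapping.lookup_inject)
  also have "\<dots> \<le> (\<Sum>f\<in>PiE (UNIV::'d set) (\<lambda>_. {..N}). \<Prod>i\<in>UNIV. q ^ f i)"
    by (intro sum_mono2 finite_PiE) (use assms N in \<open>auto intro!: prod_nonneg\<close>)
  also have "\<dots> = (\<Prod>i\<in>(UNIV::'d set). \<Sum>n\<le>N. q ^ n)"
    by (subst prod_sum_PiE) auto
  also have "\<dots> = (\<Sum>n\<le>N. q ^ n) ^ CARD('d)" by simp
  also have "\<dots> \<le> (1 / (1 - q)) ^ CARD('d)"
  proof (rule power_mono)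
    have "(\<Sum>n\<le>N. q ^ n) = (1 - q ^ Suc N) / (1 - q)"
      using assms by (simp add: sum_gp0)
    then show "(\<Sum>n\<le>N. q ^ n) \<le> 1 / (1 - q)"
      using assms by (simp add: divide_simps)
  qed (use assms in \<open>auto intro: sum_nonneg\<close>)
  finally show ?thesis .
qed

lemma norm_zpow_le:
  assumes "\<And>i. cmod (z $ i) \<le> \<rho>"
  shows "cmod (zpow z \<alpha>) \<le> \<rho> ^ mlen \<alpha>"
  unfolding zpow_def mlen_def power_sum prod_norm[symmetric] norm_power
  by (rule prod_mono) (use assms in \<open>auto intro: power_mono\<close>)

text \<open>Each term is split as p_\<alpha> (2\<rho>)^|\<alpha>| times z^\<alpha> /
  (2\<rho>)^|\<alpha>| before Cauchy-Schwarz. Doubling the radius makes the second factors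
  square-summable: the sum of 4^(-|\<alpha>|) is at most (4/3)^d.\<close>

lemma norm_eval_poly_le_weight_norm:
  fixes z :: "complex ^ 'd::finite"
  assumes "\<rho> > 0" "\<And>i. cmod (z $ i) \<le> \<rho>"
  shows "(cmod (eval_poly p z))\<^sup>2 \<le> (4/3) ^ CARD('d) * weight_norm (2 * \<rho>) p"
proof -
  let ?K = "Poly_Mapping.keys p"
  have "cmod (zpow z \<alpha> / of_real ((2 * \<rho>) ^ mlen \<alpha>)) \<le> (1/2) ^ mlen \<alpha>" for \<alpha>
    using norm_zpow_le[OF assms(2), of \<alpha>] assms(1)
    by (simp add: norm_divide norm_power norm_mult power_mult_distrib divide_simps)
  then have "(cmod (zpow z \<alpha> / of_real ((2 * \<rho>) ^ mlen \<alpha>)))\<^sup>2 \<le> ((1/2) ^ mlen \<alpha>)\<^sup>2" for \<alpha>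
    by (rule power_mono) simp
  moreover have "((1/2::real) ^ m)\<^sup>2 = (1/4) ^ m" for m :: nat
    by (simp add: power2_eq_square flip: power_mult_distrib)
  ultimately have q: "(cmod (zpow z \<alpha> / of_real ((2 * \<rho>) ^ mlen \<alpha>)))\<^sup>2 \<le> (1/4) ^ mlen \<alpha>" for \<alpha>
    by simp
  have "eval_poly p z = (\<Sum>\<alpha>\<in>?K. (coef p \<alpha> * of_real ((2 * \<rho>) ^ mlen \<alpha>)) * (zpow z \<alpha> / of_real ((2 * \<rho>) ^ mlen \<alpha>)))"
    using assms(1) by (simp add: eval_poly_eq_riesz riesz_def)
  then have "(cmod (eval_poly p z))\<^sup>2 \<le> (\<Sum>\<alpha>\<in>?K. (cmod (coef p \<alpha> * of_real ((2 * \<rho>) ^ mlen \<alpha>)))\<^sup>2)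
      * (\<Sum>\<alpha>\<in>?K. (cmod (zpow z \<alpha> / of_real ((2 * \<rho>) ^ mlen \<alpha>)))\<^sup>2)"
    by (simp only: cauchy_schwarz_sum_norm)
  also have "(\<Sum>\<alpha>\<in>?K. (cmod (coef p \<alpha> * of_real ((2 * \<rho>) ^ mlen \<alpha>)))\<^sup>2) = weight_norm (2 * \<rho>) p"
    using assms(1) by (simp add: weight_norm_def norm_mult norm_power power_mult_distrib)
  also have "weight_norm (2 * \<rho>) p * (\<Sum>\<alpha>\<in>?K. (cmod (zpow z \<alpha> / of_real ((2 * \<rho>) ^ mlen \<alpha>)))\<^sup>2)
      \<le> weight_norm (2 * \<rho>) p * (4/3) ^ CARD('d)"
  proof (rule mult_left_mono)
    have "(\<Sum>\<alpha>\<in>?K. (cmod (zpow z \<alpha> / of_real ((2 * \<rho>) ^ mlen \<alpha>)))\<^sup>2) \<le> (\<Sum>\<alpha>\<in>?K. (1/4) ^ mlen \<alpha>)"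
      by (intro sum_mono q)
    also have "\<dots> \<le> (1 / (1 - 1/4)) ^ CARD('d)"
      by (rule sum_power_mlen_le) auto
    finally show "(\<Sum>\<alpha>\<in>?K. (cmod (zpow z \<alpha> / of_real ((2 * \<rho>) ^ mlen \<alpha>)))\<^sup>2) \<le> (4/3) ^ CARD('d)"
      by simp
  qed (simp add: weight_norm_def sum_nonneg)
  finally show ?thesis by (simp add: mult.commute)
qed

section \<open>Averages over grids of roots of unity\<close>

text \<open>The sum is geometric with ratio an \<open>n\<close>-th root of unity \<open>w\<close>.
  Since both exponents are below \<open>n\<close>, the ratio is 1 only if they agree.\<close>

lemma sum_roots_unity_orthogonal:
  assumes "a < n" "b < n"
  shows "(\<Sum>k<n. cis (2 * pi * real k / real n) ^ a * cnj (cis (2 * pi * real k / real n) ^ b))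
           = (if a = b then of_nat n else 0)"
proof -
  define \<zeta> where "\<zeta> j = cis (2 * pi * real j / real n)" for j
  define w where "w = \<zeta> a * cnj (\<zeta> b)"
  have unit: "\<zeta> j * cnj (\<zeta> j) = 1" for j by (simp add: \<zeta>_def cis_cnj cis_mult)
  \<comment> \<open>Exchanging index and exponent is what exhibits each summand as a power
    \<open>w ^ k\<close>.\<close>
  have swap: "\<zeta> k ^ j = \<zeta> j ^ k" for j k
    unfolding \<zeta>_def Complex.DeMoivre by (rule arg_cong[of _ _ cis]) simp
  have "\<zeta> j ^ n = 1" for j
    using assms by (simp add: \<zeta>_def Complex.DeMoivre cis_multiple_2pi)
  then have "w ^ n = 1" by (simp add: w_def power_mult_distrib flip: complex_cnj_power)
  have "w = 1 \<longleftrightarrow> a = b"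
  proof
    assume "w = 1"
    then have "\<zeta> a = \<zeta> b"
      using unit[of b] unfolding w_def by (metis mult.assoc mult.commute mult_1)
    then show "a = b"
      using Complex.bij_betw_roots_unity[of n] assms unfolding bij_betw_def inj_on_def \<zeta>_def by auto
  qed (simp add: w_def unit)
  moreover have "(\<Sum>k<n. \<zeta> k ^ a * cnj (\<zeta> k ^ b)) = (\<Sum>k<n. w ^ k)"
    unfolding swap[of _ a] swap[of _ b] w_def by (simp add: power_mult_distrib)
  moreover have "(\<Sum>k<n. w ^ k) = 0" if "w \<noteq> 1"
    using geometric_sum[OF that, of n] \<open>w ^ n = 1\<close> by simp
  ultimately show ?thesis unfolding \<zeta>_def by auto
qed

text \<open>A discrete Parseval identity: averaging over a grid of roots of unity of order exceeding all
  exponents replaces integration over the torus.\<close>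

lemma weight_norm_eq_torus_average:
  fixes p :: "('d::finite) cpoly" and R :: real
  assumes n: "\<And>\<alpha> i. \<alpha> \<in> Poly_Mapping.keys p \<Longrightarrow> Poly_Mapping.lookup \<alpha> i < n"
  defines "z \<equiv> \<lambda>k. \<chi> i::'d. of_real R * cis (2 * pi * real (k i) / real n)"
  shows "(\<Sum>k\<in>PiE UNIV (\<lambda>_. {..<n}). (cmod (eval_poly p (z k)))\<^sup>2) = real n ^ CARD('d) * weight_norm R p"
proof -
  let ?K = "Poly_Mapping.keys p" and ?G = "PiE (UNIV::'d set) (\<lambda>_. {..<n})"
  define \<zeta> where "\<zeta> j = cis (2 * pi * real j / real n)" for j
  have zpow: "zpow (z k) \<alpha> = of_real (R ^ mlen \<alpha>) * (\<Prod>i\<in>UNIV. \<zeta> (k i) ^ Poly_Mapping.lookup \<alpha> i)" for k \<alpha>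
    by (simp add: zpow_def z_def \<zeta>_def power_mult_distrib prod.distrib mlen_def power_sum)
  have orth: "(\<Sum>k\<in>?G. zpow (z k) \<alpha> * cnj (zpow (z k) \<beta>))
      = (if \<alpha> = \<beta> then of_nat n ^ CARD('d) * of_real ((R ^ mlen \<alpha>)\<^sup>2) else 0)"
    if "\<alpha> \<in> ?K" "\<beta> \<in> ?K" for \<alpha> \<beta>
  proof -
    have "(\<Sum>k\<in>?G. zpow (z k) \<alpha> * cnj (zpow (z k) \<beta>)) = of_real (R ^ mlen \<alpha> * R ^ mlen \<beta>)
       * (\<Sum>k\<in>?G. \<Prod>i\<in>UNIV. \<zeta> (k i) ^ Poly_Mapping.lookup \<alpha> i * cnj (\<zeta> (k i) ^ Poly_Mapping.lookup \<beta> i))"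
      by (simp add: zpow prod.distrib sum_distrib_left ac_simps)
    also have "(\<Sum>k\<in>?G. \<Prod>i\<in>UNIV. \<zeta> (k i) ^ Poly_Mapping.lookup \<alpha> i * cnj (\<zeta> (k i) ^ Poly_Mapping.lookup \<beta> i))
      = (\<Prod>i\<in>UNIV. \<Sum>m<n. \<zeta> m ^ Poly_Mapping.lookup \<alpha> i * cnj (\<zeta> m ^ Poly_Mapping.lookup \<beta> i))"
      by (rule prod_sum_PiE[symmetric]) auto
    \<comment> \<open>All exponents are below \<open>n\<close>, so distinct ones cannot be confused
      on the grid.\<close>
    also have "\<dots> = (\<Prod>i\<in>UNIV. if Poly_Mapping.lookup \<alpha> i = Poly_Mapping.lookup \<beta> i then of_nat n else 0)"
      unfolding \<zeta>_def by (intro prod.cong refl sum_roots_unity_orthogonal n that)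
    also have "\<dots> = (if \<alpha> = \<beta> then of_nat n ^ CARD('d) else 0)"
      by (auto simp: poly_mapping_eq_iff fun_eq_iff)
    finally show ?thesis by (simp add: power2_eq_square)
  qed
  have "of_real (\<Sum>k\<in>?G. (cmod (eval_poly p (z k)))\<^sup>2) = (\<Sum>k\<in>?G. eval_poly p (z k) * cnj (eval_poly p (z k)))"
    by (simp add: complex_norm_square del: of_real_power)
  also have "\<dots> = (\<Sum>k\<in>?G. \<Sum>\<alpha>\<in>?K. \<Sum>\<beta>\<in>?K. coef p \<alpha> * cnj (coef p \<beta>) * (zpow (z k) \<alpha> * cnj (zpow (z k) \<beta>)))"
    by (simp add: eval_poly_eq_riesz riesz_def sum_product ac_simps)
  also have "\<dots> = (\<Sum>\<alpha>\<in>?K. \<Sum>\<beta>\<in>?K. \<Sum>k\<in>?G. coef p \<alpha> * cnj (coef p \<beta>) * (zpow (z k) \<alpha> * cnj (zpow (z k) \<beta>)))"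
    by (subst sum.swap, rule sum.cong[OF refl], rule sum.swap)
  \<comment> \<open>Orthogonality leaves only the diagonal terms.\<close>
  also have "\<dots> = (\<Sum>\<alpha>\<in>?K. coef p \<alpha> * cnj (coef p \<alpha>) * (of_nat n ^ CARD('d) * of_real ((R ^ mlen \<alpha>)\<^sup>2)))"
    by (simp add: orth if_distrib flip: sum_distrib_left cong: if_cong)
  also have "\<dots> = of_real (real n ^ CARD('d) * weight_norm R p)"
    unfolding weight_norm_def sum_distrib_left of_real_sum
    by (intro sum.cong refl) (simp add: complex_norm_square[symmetric] power_mult_distrib ac_simps)
  finally show ?thesis by (simp only: of_real_eq_iff)
qed

section \<open>Equivalence of locally bounded kernels and positive eigenvalue limits\<close>

theorem theorem2p1:
  fixes s :: "('d::{finite,linorder} \<Rightarrow>\<^sub>0 nat) \<Rightarrow> complex"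
  assumes "pos_multiseq s"
    and "s 0 = 1"
    and "\<exists>R>0. \<forall>N. min_eigenvalue s R N > 0"
  shows "(\<forall>E :: (complex ^ 'd::{finite,linorder}) set. compact E \<longrightarrow>
            (\<exists>M::real. \<forall>z\<in>E.
               (\<lambda>\<alpha>. (cmod (eval_poly (orth_poly s \<alpha>) z))\<^sup>2) summable_on UNIV \<and>
               (\<Sum>\<^sub>\<infinity>\<alpha>. (cmod (eval_poly (orth_poly s \<alpha>) z))\<^sup>2) \<le> M))
         \<longleftrightarrow> (\<forall>R>0. gamma_lim s R > 0)"
proof -
  \<comment> \<open>One radius suffices: \<open>N\<close> is taken large enough for the support of
    \<open>p\<close>, and the weighted norm of a nonzero polynomial is positive.\<close>
  have "0 < Re (ip s p p)" if "p \<noteq> 0" for p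
  proof -
    obtain R where "R > 0" and R: "\<And>N. min_eigenvalue s R N > 0"
      using assms(3) by blast
    obtain N where keys: "Poly_Mapping.keys p \<subseteq> {\<alpha>. mlen \<alpha> \<le> N}"
      using finite_imp_mlen_bounded[OF finite_keys] .
    from that obtain \<alpha> where "\<alpha> \<in> Poly_Mapping.keys p" by (metis ex_in_conv keys_eq_empty)
    then have "weight_norm R p > 0"
      unfolding weight_norm_def using \<open>R > 0\<close> by (intro sum_pos2[of _ \<alpha>]) (auto simp: in_keys_iff)
    with R[of N] have "0 < min_eigenvalue s R N * weight_norm R p" by simp
    also have "\<dots> \<le> Re (ip s p p)"
      by (rule min_eigenvalue_rayleigh(2)[OF assms(1) \<open>R > 0\<close> keys])
    finally show ?thesis .
  qed
  with assms(1) interpret posdef_multiseq s by unfold_locales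
  let ?f = "\<lambda>z \<alpha>. (cmod (eval_poly (orth_poly s \<alpha>) z))\<^sup>2"
  show ?thesis
  proof (intro iffI allI impI)
    fix R :: real
    assume kernel: "\<forall>E :: (complex ^ 'd::{finite,linorder}) set. compact E \<longrightarrow>
      (\<exists>M. \<forall>z\<in>E. ?f z summable_on UNIV \<and> infsum (?f z) UNIV \<le> M)" and "R > 0"
    \<comment> \<open>This ball contains the torus of radius \<open>R\<close>, since the norm is at
      most the sum of the coordinate moduli.\<close>
    define E where "E = cball (0 :: complex ^ 'd::{finite,linorder}) (R * CARD('d))"
    have "compact E" by (simp add: E_def)
    with kernel obtain M where M: "\<And>z. z \<in> E \<Longrightarrow> ?f z summable_on UNIV \<and> infsum (?f z) UNIV \<le> M"
      by blast
    \<comment> \<open>The maximum with 1 makes \<open>1 / M'\<close> a positive number, to serve as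
      the \<epsilon> of \<open>gamma_lim_pos_iff\<close>.\<close>
    define M' where "M' = max M 1"
    have eval: "(cmod (eval_poly p z))\<^sup>2 \<le> M' * Re (ip s p p)" if "z \<in> E" for z p
    proof -
      have "sum (?f z) F \<le> M'" if "finite F" for F
        using finite_sum_le_infsum[of "?f z" UNIV F] M[OF \<open>z \<in> E\<close>] that
        unfolding M'_def by force
      then show ?thesis using kernel_bound_iff[of M' z] by (simp add: M'_def)
    qed
    have "1 / M' * weight_norm R p \<le> Re (ip s p p)" for p
    proof -
      obtain N where "Poly_Mapping.keys p \<subseteq> {\<alpha>. mlen \<alpha> \<le> N}"
        using finite_imp_mlen_bounded[OF finite_keys] .
      then have n: "Poly_Mapping.lookup \<alpha> i < Suc N" if "\<alpha> \<in> Poly_Mapping.keys p" for \<alpha> i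
        using that lookup_le_mlen[of \<alpha> i] by fastforce
      \<comment> \<open>The successor makes all exponents strictly smaller than the order of the
        roots of unity.\<close>
      define n where "n = Suc N"
      define z where "z k = (\<chi> i::'d::{finite,linorder}. of_real R * cis (2 * pi * real (k i) / real n))" for k
      have "z k \<in> E" for k
      proof -
        have "norm (z k) \<le> (\<Sum>i\<in>UNIV. norm (z k $ i))"
          unfolding norm_vec_def by (rule L2_set_le_sum) simp
        also have "\<dots> = R * CARD('d)"
          using \<open>R > 0\<close> by (simp add: z_def norm_mult)
        finally show ?thesis by (simp add: E_def)
      qed
      \<comment> \<open>The pointwise bound is summed over the n^d grid points; the same factor
        appears in the torus average and cancels.\<close>
      then have "(\<Sum>k\<in>PiE UNIV (\<lambda>_. {..<n}). (cmod (eval_poly p (z k)))\<^sup>2)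
          \<le> of_nat (card (PiE (UNIV::'d set) (\<lambda>_. {..<n}))) * (M' * Re (ip s p p))"
        by (intro sum_bounded_above eval)
      moreover have "(\<Sum>k\<in>PiE UNIV (\<lambda>_. {..<n}). (cmod (eval_poly p (z k)))\<^sup>2) = real n ^ CARD('d) * weight_norm R p"
        unfolding z_def n_def by (rule weight_norm_eq_torus_average) (rule n)
      ultimately have "real n ^ CARD('d) * weight_norm R p \<le> real n ^ CARD('d) * (M' * Re (ip s p p))"
        by (simp add: card_PiE)
      then have "weight_norm R p \<le> M' * Re (ip s p p)"
        by (simp add: n_def)
      then show ?thesis by (simp add: M'_def divide_simps mult.commute)
    qed
    moreover have "1 / M' > 0" by (simp add: M'_def)
    ultimately show "gamma_lim s R > 0"
      unfolding gamma_lim_pos_iff[OF assms(1) \<open>R > 0\<close>] by blast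
  next
    fix E :: "(complex ^ 'd::{finite,linorder}) set"
    assume gamma: "\<forall>R>0. gamma_lim s R > 0" and "compact E"
    then obtain \<rho> where "\<rho> > 0" and \<rho>: "\<And>z. z \<in> E \<Longrightarrow> norm z \<le> \<rho>"
      using compact_imp_bounded bounded_pos by metis
    \<comment> \<open>The radius is doubled to match
      \<open>norm_eval_poly_le_weight_norm\<close>.\<close>
    from \<open>\<rho> > 0\<close> gamma have "gamma_lim s (2 * \<rho>) > 0" by simp
    then obtain \<epsilon> where "\<epsilon> > 0" and \<epsilon>: "\<And>p. \<epsilon> * weight_norm (2 * \<rho>) p \<le> Re (ip s p p)"
      using gamma_lim_pos_iff[OF assms(1), of "2 * \<rho>"] \<open>\<rho> > 0\<close> by auto
    define M where "M = (4/3) ^ CARD('d) / \<epsilon>"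
    have "M \<ge> 0" using \<open>\<epsilon> > 0\<close> by (simp add: M_def)
    show "\<exists>M. \<forall>z\<in>E. ?f z summable_on UNIV \<and> infsum (?f z) UNIV \<le> M"
    proof (intro exI ballI)
      fix z
      assume "z \<in> E"
      have "(cmod (eval_poly p z))\<^sup>2 \<le> M * Re (ip s p p)" for p
      proof -
        have "cmod (z $ i) \<le> \<rho>" for i
          using Finite_Cartesian_Product.norm_nth_le[of z i] \<rho>[OF \<open>z \<in> E\<close>] by simp
        then have "(cmod (eval_poly p z))\<^sup>2 \<le> (4/3) ^ CARD('d) * weight_norm (2 * \<rho>) p"
          by (rule norm_eval_poly_le_weight_norm[OF \<open>\<rho> > 0\<close>])
        also have "\<dots> = M * (\<epsilon> * weight_norm (2 * \<rho>) p)"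
          using \<open>\<epsilon> > 0\<close> by (simp add: M_def)
        also have "\<dots> \<le> M * Re (ip s p p)"
          by (rule mult_left_mono[OF \<epsilon> \<open>M \<ge> 0\<close>])
        finally show ?thesis .
      qed
      then have bound: "sum (?f z) F \<le> M" if "finite F" for F
        using kernel_bound_iff[OF \<open>M \<ge> 0\<close>, of z] that by blast
      \<comment> \<open>For nonnegative terms the uniform bound on finite sums yields both
        summability and the bound on the infinite sum.\<close>
      have "?f z summable_on UNIV"
        by (rule nonneg_bdd_above_summable_on) (use bound in \<open>auto simp: bdd_above_def\<close>)
      then show "?f z summable_on UNIV \<and> infsum (?f z) UNIV \<le> M"
        by (intro conjI infsum_le_finite_sums bound)
    qed
  qed
qed

end
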